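(* Let $h:[0,1]\to\mathbb R$ be continuous and increasing with $h(0)=0$ and $h(1)=1$, and consider the dual utility $I_h$ on $\mathcal M_c$. Then probabilistic risk aversion is equivalent to strong risk aversion: $I_h$ is p-quasi-convex on $\mathcal M_c$ if and only if $I_h$ is concave-order monotone.
   Context: A distribution is a Borel probability measure on $\mathbb R$; $\mathcal M_c$ is the set of compactly supported distributions. "Increasing" is in the non-strict sense. For $F\in\mathcal M_c$, $I_h(F)=\int_0^\infty h(F((x,\infty)))\,dx+\int_{-\infty}^0\big(h(F((x,\infty)))-h(1)\big)\,dx$. $\rho:\mathcal M_c\to\mathbb R$ is p-quasi-convex (the preference it represents is probabilistically risk averse) if $\rho(\lambda F+(1-\lambda)G)\le\max\{\rho(F),\rho(G)\}$ for all $F,G\in\mathcal M_c$, $\lambda\in[0,1]$. $\rho$ is concave-order monotone (the preference it represents is strongly risk averse) if $\rho(F)\le\rho(G)$ for all $F,G\in\mathcal M_c$ such that $\int f\,dF\le\int f\,dG$ for all concave $f:\mathbb R\to\mathbb R$. *)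

theory Defs
  imports "HOL-Probability.Probability"
begin

text \<open>A distribution in the sense of \<^term>\<open>real_distribution\<close> is compactly supported
  if it gives full mass to some compact set.\<close>

definition compact_distributions :: "real measure set" where
  "compact_distributions =
     {F. real_distribution F \<and> (\<exists>K. compact K \<and> measure F K = 1)}"

definition mixture :: "real \<Rightarrow> real measure \<Rightarrow> real measure \<Rightarrow> real measure" where
  "mixture l F G =
     measure_of UNIV (sets borel)
       (\<lambda>A. ennreal l * emeasure F A + ennreal (1 - l) * emeasure G A)"

text \<open>The distortion \<open>h\<close> is a total function, but only its values on \<open>{0..1}\<close> are used.
  For compactly supported \<open>F\<close>, monotone \<open>h\<close> on \<open>{0..1}\<close> and \<open>h 0 = 0\<close>, both integrands are
  bounded, Borel and vanish outside a bounded set, so both integrals exist.\<close>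

definition dual_utility :: "(real \<Rightarrow> real) \<Rightarrow> real measure \<Rightarrow> real" where
  "dual_utility h F =
     (LBINT x:{0..}. h (measure F {x<..})) + (LBINT x:{..0}. h (measure F {x<..}) - h 1)"

definition p_quasi_convex :: "(real measure \<Rightarrow> real) \<Rightarrow> bool" where
  "p_quasi_convex \<rho> \<longleftrightarrow>
     (\<forall>F\<in>compact_distributions. \<forall>G\<in>compact_distributions. \<forall>l\<in>{0..1}.
        \<rho> (mixture l F G) \<le> max (\<rho> F) (\<rho> G))"

text \<open>A concave function on the whole line is continuous, hence integrable with respect to any
  compactly supported distribution.\<close>

definition concave_order :: "real measure \<Rightarrow> real measure \<Rightarrow> bool" where
  "concave_order F G \<longleftrightarrow>
     (\<forall>f :: real \<Rightarrow> real. concave_on UNIV f \<longrightarrow> integral\<^sup>L F f \<le> integral\<^sup>L G f)"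

definition concave_order_monotone :: "(real measure \<Rightarrow> real) \<Rightarrow> bool" where
  "concave_order_monotone \<rho> \<longleftrightarrow>
     (\<forall>F\<in>compact_distributions. \<forall>G\<in>compact_distributions.
        concave_order F G \<longrightarrow> \<rho> F \<le> \<rho> G)"

lemma sets_mixture [simp, measurable_cong]: "sets (mixture l F G) = sets borel"
  unfolding mixture_def
  using sets.sigma_sets_eq[of "borel :: real measure"] by (simp add: sets_measure_of_conv)

lemma space_mixture [simp]: "space (mixture l F G) = UNIV"
  by (simp add: mixture_def space_measure_of_conv)

lemma emeasure_mixture:
  assumes F: "sets F = sets borel" and G: "sets G = sets borel" and A: "A \<in> sets borel"
  shows "emeasure (mixture l F G) A = ennreal l * emeasure F A + ennreal (1 - l) * emeasure G A"
  unfolding mixture_def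
proof (rule emeasure_measure_of_sigma)
  show "sigma_algebra UNIV (sets (borel :: real measure))"
    by (metis sets.sigma_algebra_axioms space_borel)
  show "positive (sets borel) (\<lambda>A. ennreal l * emeasure F A + ennreal (1 - l) * emeasure G A)"
    by (simp add: positive_def)
  show "countably_additive (sets borel)
          (\<lambda>A. ennreal l * emeasure F A + ennreal (1 - l) * emeasure G A)"
  proof (rule countably_additiveI)
    fix B :: "nat \<Rightarrow> real set"
    assume B: "range B \<subseteq> sets borel" "disjoint_family B"
    have "(\<Sum>i. ennreal l * emeasure F (B i) + ennreal (1 - l) * emeasure G (B i)) =
        ennreal l * (\<Sum>i. emeasure F (B i)) + ennreal (1 - l) * (\<Sum>i. emeasure G (B i))"
      by (simp add: suminf_add[symmetric] ennreal_suminf_cmult)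
    then show "(\<Sum>i. ennreal l * emeasure F (B i) + ennreal (1 - l) * emeasure G (B i)) =
        ennreal l * emeasure F (\<Union>i. B i) + ennreal (1 - l) * emeasure G (\<Union>i. B i)"
      using B F G by (simp add: suminf_emeasure)
  qed
qed (rule A)

lemma mixture_compact_distributions:
  assumes F: "F \<in> compact_distributions" and G: "G \<in> compact_distributions"
    and l: "l \<in> {0..1}"
  shows "mixture l F G \<in> compact_distributions"
proof -
  from F obtain K where K: "real_distribution F" "compact K" "measure F K = 1"
    by (auto simp: compact_distributions_def)
  from G obtain L where L: "real_distribution G" "compact L" "measure G L = 1"
    by (auto simp: compact_distributions_def)
  interpret F: real_distribution F by (rule K)
  interpret G: real_distribution G by (rule L)
  have one: "emeasure (mixture l F G) A = 1"
    if A: "A \<in> sets borel" and K_A: "K \<subseteq> A" and L_A: "L \<subseteq> A" for A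
  proof -
    have "measure F A = 1"
      using F.finite_measure_mono[OF K_A] A K F.prob_le_1[of A] by simp
    moreover have "measure G A = 1"
      using G.finite_measure_mono[OF L_A] A L G.prob_le_1[of A] by simp
    ultimately show ?thesis
      using l A
      by (simp add: emeasure_mixture F.emeasure_eq_measure G.emeasure_eq_measure
          ennreal_plus[symmetric] del: ennreal_plus)
  qed
  have "real_distribution (mixture l F G)"
    using one[of UNIV] by (intro real_distribution.intro prob_spaceI real_distribution_axioms.intro) simp_all
  moreover have "compact (K \<union> L)"
    using K L by (intro compact_Un)
  moreover have "measure (mixture l F G) (K \<union> L) = 1"
    using one[of "K \<union> L"] \<open>compact (K \<union> L)\<close> by (simp add: measure_def borel_compact)
  ultimately show ?thesis
    by (auto simp: compact_distributions_def)
qed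

end

theory Submission
  imports Defs
begin

text \<open>Both properties are equivalent to convexity of \<open>h\<close> on \<open>[0,1]\<close>.

  If \<open>h\<close> is convex, then the dual utility is convex in the tail function, hence p-quasi-convex;
  and a subgradient of \<open>h\<close> along the tail of \<open>F\<close> is a decreasing function of the outcome, whose
  primitive is a concave test function for the concave order.

  Conversely, for three-point distributions with tail values \<open>p \<ge> q\<close> on adjacent intervals of
  lengths \<open>w, w'\<close> the dual utility is \<open>w * h p + w' * h q\<close>. Monotonicity in the concave order
  gives midpoint convexity at once. Under p-quasi-convexity, mixing two such distributions of equal
  utility bounds the sum of the relative midpoint defects of \<open>h\<close> on two non-overlapping intervals
  by \<open>0\<close>. So if \<open>h\<close> fails midpoint convexity on one interval, its midpoint defect is uniformly negative
  on all intervals disjoint from it; this forces \<open>h\<close> to be constant on either side of it, and the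
  bad interval can be chosen so small that this is impossible.\<close>

section \<open>Midpoint criteria for convexity of real functions\<close>

text \<open>Subtracting a violated chord leaves a function \<open>g\<close> that is zero at both
  ends and positive somewhere between; \<open>p\<close> is a maximiser of \<open>g\<close>. The
  affine part cancels in symmetric midpoints, so the bump persists for all small \<open>e\<close>;
  this later lets the bad interval shrink.\<close>

lemma not_convex_on_local_bump:
  fixes h :: "real \<Rightarrow> real"
  assumes cont: "continuous_on {a..b} h" and nc: "\<not> convex_on {a..b} h"
  obtains p e0 where "0 < e0" "a \<le> p - e0" "p + e0 \<le> b"
    "\<And>e. 0 < e \<Longrightarrow> e \<le> e0 \<Longrightarrow> (h (p - e) + h (p + e)) / 2 < h p"
proof -
  have "\<not> (\<forall>t x y. 0 < t \<longrightarrow> t < 1 \<longrightarrow> x \<in> {a..b} \<longrightarrow> y \<in> {a..b} \<longrightarrow> x < y \<longrightarrow>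
      h ((1 - t) *\<^sub>R x + t *\<^sub>R y) \<le> (1 - t) * h x + t * h y)"
    using nc convex_on_linorderI[of "{a..b}" h, OF _ convex_real_interval(5)] by blast
  then obtain t x y where t: "0 < t" "t < 1" and xy: "a \<le> x" "x < y" "y \<le> b"
    and gt: "(1 - t) * h x + t * h y < h ((1 - t) * x + t * y)"
    by (auto simp: not_le)
  define s where "s = (h y - h x) / (y - x)"
  define g where "g z = h z - (h x + s * (z - x))" for z
  have s: "s * (y - x) = h y - h x"
    using xy by (simp add: s_def)
  have gx: "g x = 0" and gy: "g y = 0"
    using s by (simp_all add: g_def)
  have contg: "continuous_on {x..y} g"
    unfolding g_def using xy by (intro continuous_intros continuous_on_subset[OF cont]) auto
  obtain m where m: "m \<in> {x..y}" "\<And>z. z \<in> {x..y} \<Longrightarrow> g z \<le> g m"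
    using continuous_attains_sup[OF compact_Icc _ contg] xy by auto
  define q where "q = (1 - t) * x + t * y"
  have q: "q = x + t * (y - x)"
    by (simp add: q_def algebra_simps)
  have "0 \<le> t * (y - x)" "t * (y - x) \<le> 1 * (y - x)"
    using t xy by (simp, intro mult_right_mono) auto
  then have "q \<in> {x..y}"
    by (simp add: q)
  moreover have "g q = h q - ((1 - t) * h x + t * h y)"
  proof -
    have "g q = h q - (h x + t * (s * (y - x)))"
      by (simp add: g_def q)
    then show ?thesis
      unfolding s by (simp add: algebra_simps)
  qed
  then have "0 < g q"
    using gt by (simp add: q_def)
  ultimately have gm: "0 < g m"
    using m(2) by fastforce
  define Z where "Z = {z \<in> {x..y}. g z = g m}"
  have "compact Z"
  proof -
    have "closed {z \<in> {x..y}. g z = g m}"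
      using continuous_closed_preimage_constant[OF contg closed_atLeastAtMost] by simp
    then have "compact ({x..y} \<inter> Z)"
      unfolding Z_def by (intro compact_Int_closed) auto
    then show ?thesis by (simp add: Z_def Int_def conj_ac)
  qed
  moreover have "Z \<noteq> {}"
    using m by (auto simp: Z_def)
  \<comment> \<open>Taking the last maximiser makes \<open>g (p + e) < g p\<close> strict; on the
    left \<open>g (p - e) \<le> g p\<close> suffices.\<close>
  ultimately obtain p where p: "p \<in> Z" "\<And>z. z \<in> Z \<Longrightarrow> z \<le> p"
    using compact_attains_sup[of Z] by auto
  have gp: "g p = g m" "x \<le> p" "p \<le> y"
    using p by (auto simp: Z_def)
  have "x < p" "p < y"
    using gp gm gx gy by (metis less_irrefl order_le_imp_less_or_eq)+
  define e0 where "e0 = min (p - x) (y - p)"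
  show thesis
  proof
    show "0 < e0" "a \<le> p - e0" "p + e0 \<le> b"
      using \<open>x < p\<close> \<open>p < y\<close> xy by (auto simp: e0_def)
    fix e assume e: "0 < e" "e \<le> e0"
    then have in_xy: "p - e \<in> {x..y}" "p + e \<in> {x..y}"
      using \<open>x < p\<close> \<open>p < y\<close> by (auto simp: e0_def)
    have "g (p - e) \<le> g p"
      using m(2)[OF in_xy(1)] gp by simp
    moreover have "g (p + e) < g p"
      using m(2)[OF in_xy(2)] p(2)[of "p + e"] in_xy e gp by (auto simp: Z_def less_le)
    ultimately show "(h (p - e) + h (p + e)) / 2 < h p"
      unfolding g_def by (simp add: algebra_simps)
  qed
qed

lemma midpoint_convex_imp_convex_on:
  fixes h :: "real \<Rightarrow> real"
  assumes cont: "continuous_on {a..b} h"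
    and mid: "\<And>l r. a \<le> l \<Longrightarrow> l \<le> r \<Longrightarrow> r \<le> b \<Longrightarrow> h ((l + r) / 2) \<le> (h l + h r) / 2"
  shows "convex_on {a..b} h"
proof (rule ccontr)
  assume "\<not> convex_on {a..b} h"
  then obtain p e where "0 < e" "a \<le> p - e" "p + e \<le> b" "(h (p - e) + h (p + e)) / 2 < h p"
    using not_convex_on_local_bump[OF cont] by (metis order_refl)
  then show False
    using mid[of "p - e" "p + e"] by simp
qed

text \<open>Halving an interval repeatedly towards an interior point, the slopes would grow like
  \<open>(1 + 2 d) ^ n\<close>, which is impossible for a convex function.\<close>

lemma uniformly_midpoint_convex_const:
  fixes h :: "real \<Rightarrow> real"
  assumes cont: "continuous_on {u..v} h" and mono: "mono_on {u..v} h" and d: "0 < d"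
    and mid: "\<And>l r. u \<le> l \<Longrightarrow> l \<le> r \<Longrightarrow> r \<le> v \<Longrightarrow>
      h ((l + r) / 2) \<le> (h l + h r) / 2 - d * (h r - h l)"
    and "u \<le> v"
  shows "h u = h v"
proof (rule ccontr)
  assume "h u \<noteq> h v"
  moreover have "h u \<le> h v"
    using \<open>u \<le> v\<close> by (intro mono_onD[OF mono]) auto
  ultimately have uv: "u < v" "h u < h v"
    using \<open>u \<le> v\<close> by (auto simp: less_le)
  have conv: "convex_on {u..v} h"
  proof (rule midpoint_convex_imp_convex_on[OF cont])
    fix l r assume "u \<le> l" "l \<le> r" "r \<le> v"
    then have "0 \<le> h r - h l"
      using mono_onD[OF mono, of l r] by simp
    then have "0 \<le> d * (h r - h l)"
      using d by simp
    then show "h ((l + r) / 2) \<le> (h l + h r) / 2"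
      using mid[of l r] \<open>u \<le> l\<close> \<open>l \<le> r\<close> \<open>r \<le> v\<close> by linarith
  qed
  \<comment> \<open>\<open>y\<close> has to lie strictly inside: \<open>h\<close> still increases on
    \<open>{u..y}\<close>, and by convexity the slope \<open>C\<close> of the chord from
    \<open>y\<close> to \<open>v\<close> bounds every slope on an interval ending at
    \<open>y\<close>.\<close>
  obtain y where y: "u \<le> y" "y \<le> v" "h y = (h u + h v) / 2"
    using IVT'[of h u "(h u + h v) / 2" v] uv cont by auto
  have hy: "h u < h y" "h y < h v"
    using y uv by auto
  then have "y \<noteq> u" "y \<noteq> v"
    by auto
  then have y': "u < y" "y < v"
    using y by auto
  define C where "C = (h y - h v) / (y - v)"
  define x where "x n = y - (y - u) / 2 ^ n" for n :: nat
  have x: "u \<le> x n" "x n < y" for n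
  proof -
    have "(y - u) / 2 ^ n \<le> (y - u) / 1"
      using y' by (intro divide_left_mono) auto
    moreover have "0 < (y - u) / 2 ^ n"
      using y' by simp
    ultimately show "u \<le> x n" "x n < y"
      by (auto simp: x_def)
  qed
  \<comment> \<open>Each halving of the length keeps at least the fraction \<open>1 / 2 + d\<close>
    of the increment of \<open>h\<close>, so the slope on \<open>{x n..y}\<close> gains a factor of
    at least \<open>1 + 2 * d\<close>.\<close>
  have grow: "(1 / 2 + d) ^ n * (h y - h u) \<le> h y - h (x n)" for n
  proof (induction n)
    case 0
    show ?case by (simp add: x_def)
  next
    case (Suc n)
    have "x (Suc n) = (x n + y) / 2"
      by (simp add: x_def field_simps)
    then have "h (x (Suc n)) \<le> (h (x n) + h y) / 2 - d * (h y - h (x n))"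
      using mid[of "x n" y] x[of n] y(2) by (metis less_imp_le)
    then have "(1 / 2 + d) * (h y - h (x n)) \<le> h y - h (x (Suc n))"
      by (simp add: field_simps)
    moreover have "(1 / 2 + d) * ((1 / 2 + d) ^ n * (h y - h u)) \<le> (1 / 2 + d) * (h y - h (x n))"
      using Suc d by (intro mult_left_mono) auto
    ultimately show ?case
      by (simp add: mult.assoc)
  qed
  have "(1 + 2 * d) ^ n \<le> C * (y - u) / (h y - h u)" for n
  proof -
    have "(h (x n) - h y) / (x n - y) \<le> C"
      unfolding C_def using x[of n] y'
      by (intro order_trans[OF convex_on_slope_le(1)[OF conv, of "x n" v y]
            convex_on_slope_le(2)[OF conv, of "x n" v y]]) auto
    then have "h y - h (x n) \<le> C * (y - x n)"
      using x(2)[of n] by (simp add: field_simps)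
    with grow[of n] have "(1 / 2 + d) ^ n * (h y - h u) \<le> C * ((y - u) / 2 ^ n)"
      by (simp add: x_def)
    then have "2 ^ n * ((1 / 2 + d) ^ n * (h y - h u)) \<le> 2 ^ n * (C * ((y - u) / 2 ^ n))"
      by (intro mult_left_mono) auto
    moreover have "(1 + 2 * d) ^ n = 2 ^ n * (1 / 2 + d) ^ n"
      by (simp add: power_mult_distrib[symmetric] algebra_simps)
    ultimately have "(1 + 2 * d) ^ n * (h y - h u) \<le> C * (y - u)"
      by simp
    then show ?thesis
      using hy by (simp add: pos_le_divide_eq)
  qed
  moreover obtain n where "C * (y - u) / (h y - h u) < (1 + 2 * d) ^ n"
    using real_arch_pow[of "1 + 2 * d"] d by auto
  ultimately show False
    by (meson not_le)
qed

text \<open>When both increments are positive, dividing \<open>cross\<close> by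
  \<open>(h v - h u) * (h b - h a)\<close> says that the relative midpoint excesses
  \<open>(h ((l + r) / 2) - (h l + h r) / 2) / (h r - h l)\<close> of \<open>{u..v}\<close> and
  \<open>{a..b}\<close> have sum at most \<open>0\<close>. A bump around \<open>p\<close> thus
  forces the strengthened midpoint inequality on both sides of it.\<close>

lemma crossed_quasi_convexity_imp_convex_on:
  fixes h :: "real \<Rightarrow> real"
  assumes cont: "continuous_on {0..1} h" and mono: "mono_on {0..1} h"
    and cross: "\<And>u v a b. 0 \<le> u \<Longrightarrow> u \<le> v \<Longrightarrow> v \<le> a \<Longrightarrow> a \<le> b \<Longrightarrow> b \<le> 1 \<Longrightarrow>
      (h v - h u) * h ((a + b) / 2) + (h b - h a) * h ((u + v) / 2) \<le> h b * h v - h a * h u"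
  shows "convex_on {0..1} h"
proof (rule ccontr)
  assume "\<not> convex_on {0..1} h"
  then obtain p e0 where e0: "0 < e0" "0 \<le> p - e0" "p + e0 \<le> 1"
    and bump: "\<And>e. 0 < e \<Longrightarrow> e \<le> e0 \<Longrightarrow> (h (p - e) + h (p + e)) / 2 < h p"
    using not_convex_on_local_bump[OF cont] by metis
  have False if e: "0 < e" "e \<le> e0" and strict: "h 0 < h (p - e) \<or> h (p + e) < h 1" for e
  proof -
    define a where "a = p - e"
    define b where "b = p + e"
    have ab: "0 \<le> a" "a < b" "b \<le> 1" "(a + b) / 2 = p"
      using e e0 by (auto simp: a_def b_def)
    define c where "c = h p - (h a + h b) / 2"
    have c: "0 < c"
      using bump[OF e] by (simp add: c_def a_def b_def)
    have hp: "h p = (h a + h b) / 2 + c"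
      by (simp add: c_def)
    have "h a \<le> h p" "h p \<le> h b"
      using e ab by (auto intro!: mono_onD[OF mono] simp: a_def b_def)
    with c have hab: "0 < h b - h a"
      by (simp add: c_def)
    \<comment> \<open>The relative excess of the bump; it depends on the bump only, hence is uniform
      over all intervals beside it.\<close>
    define d where "d = c / (h b - h a)"
    have d: "0 < d" "c = d * (h b - h a)"
      using c hab by (simp_all add: d_def)
    have decay: "h ((u + v) / 2) \<le> (h u + h v) / 2 - d * (h v - h u)"
      if "(h v - h u) * h p + (h b - h a) * h ((u + v) / 2) \<le> h b * h v - h a * h u" for u v
    proof -
      have "h b * h v - h a * h u - (h v - h u) * h p =
          (h b - h a) * ((h u + h v) / 2 - d * (h v - h u))"
        unfolding hp d(2) by (simp add: field_simps)
      with that have "(h b - h a) * h ((u + v) / 2) \<le>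
          (h b - h a) * ((h u + h v) / 2 - d * (h v - h u))"
        by linarith
      then show ?thesis
        using hab by simp
    qed
    have "h 0 = h a"
    proof (rule uniformly_midpoint_convex_const[where h = h, OF _ _ d(1)])
      show "continuous_on {0..a} h" "mono_on {0..a} h" "0 \<le> a"
        using cont mono ab by (auto intro: continuous_on_subset mono_on_subset)
      fix l r assume "0 \<le> l" "l \<le> r" "r \<le> a"
      then show "h ((l + r) / 2) \<le> (h l + h r) / 2 - d * (h r - h l)"
        using cross[of l r a b] ab by (intro decay) simp
    qed
    moreover have "h b = h 1"
    proof (rule uniformly_midpoint_convex_const[where h = h, OF _ _ d(1)])
      show "continuous_on {b..1} h" "mono_on {b..1} h" "b \<le> 1"
        using cont mono ab by (auto intro: continuous_on_subset mono_on_subset)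
      fix l r assume "b \<le> l" "l \<le> r" "r \<le> 1"
      then show "h ((l + r) / 2) \<le> (h l + h r) / 2 - d * (h r - h l)"
        using cross[of a b l r] ab by (intro decay) (simp add: mult.commute add.commute)
    qed
    ultimately show False
      using strict by (simp add: a_def b_def)
  qed
  then have not_strict: "\<not> (h 0 < h (p - e) \<or> h (p + e) < h 1)" if "0 < e" "e \<le> e0" for e
    using that by blast
  \<comment> \<open>Every small bump size is allowed, so \<open>h\<close> takes only the value
    \<open>h 0\<close> just left of \<open>p\<close> and only the value \<open>h 1\<close> just
    right of it.\<close>
  have flat: "h (p - e) = h 0" "h (p + e) = h 1" if "0 < e" "e \<le> e0" for e
  proof -
    have "h 0 \<le> h (p - e)" "h (p + e) \<le> h 1"
      using that e0 by (auto intro!: mono_onD[OF mono])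
    then show "h (p - e) = h 0" "h (p + e) = h 1"
      using not_strict[OF that] by auto
  qed
  \<comment> \<open>Otherwise a value strictly between would be attained strictly left of
    \<open>p\<close>, within distance \<open>e0\<close>, where \<open>h\<close> equals
    \<open>h 0\<close>. The right side is symmetric.\<close>
  have "h p = h 0"
  proof (rule ccontr)
    assume "h p \<noteq> h 0"
    moreover have "h 0 \<le> h p"
      using e0 by (intro mono_onD[OF mono]) auto
    ultimately have lt: "h (p - e0) < h p"
      using flat[of e0] e0 by simp
    then obtain x where x: "p - e0 \<le> x" "x \<le> p" "h x = (h (p - e0) + h p) / 2"
      using IVT'[of h "p - e0" "(h (p - e0) + h p) / 2" p] e0 continuous_on_subset[OF cont, of "{p - e0..p}"] by auto
    then have "x \<noteq> p"
      using lt by auto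
    then show False
      using flat(1)[of "p - x"] flat(1)[of e0] x lt e0 by simp
  qed
  moreover have "h p = h 1"
  proof (rule ccontr)
    assume "h p \<noteq> h 1"
    moreover have "h p \<le> h 1"
      using e0 by (intro mono_onD[OF mono]) auto
    ultimately have lt: "h p < h (p + e0)"
      using flat[of e0] e0 by simp
    then obtain x where x: "p \<le> x" "x \<le> p + e0" "h x = (h p + h (p + e0)) / 2"
      using IVT'[of h p "(h p + h (p + e0)) / 2" "p + e0"] e0 continuous_on_subset[OF cont, of "{p..p + e0}"] by auto
    then have "x \<noteq> p"
      using lt by auto
    then show False
      using flat(2)[of "x - p"] flat(2)[of e0] x lt e0 by simp
  qed
  ultimately show False
    using bump[of e0] flat[of e0] e0 by simp
qed

section \<open>Compact supports, tail functions and the dual utility\<close>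

lemma compact_distributions_obtain_Icc:
  assumes "F \<in> compact_distributions"
  obtains M where "0 \<le> M" "measure F {-M..M} = 1"
proof -
  from assms obtain K where K: "real_distribution F" "compact K" "measure F K = 1"
    by (auto simp: compact_distributions_def)
  interpret real_distribution F by (rule K)
  obtain M where M: "\<And>x. x \<in> K \<Longrightarrow> norm x \<le> M"
    using compact_imp_bounded[OF K(2)] unfolding bounded_iff by blast
  have "measure F K \<le> measure F {-max 0 M..max 0 M}"
    using M by (intro finite_measure_mono) (fastforce simp: abs_le_iff max_def)+
  then have "measure F {-max 0 M..max 0 M} = 1"
    using K prob_le_1 by (intro antisym) auto
  then show thesis
    by (intro that[of "max 0 M"]) auto
qed

lemma compact_distributions_obtain_common_Icc:
  assumes "F \<in> compact_distributions" "G \<in> compact_distributions"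
  obtains M where "0 \<le> M" "measure F {-M..M} = 1" "measure G {-M..M} = 1"
proof -
  obtain M where M: "0 \<le> M" "measure F {-M..M} = 1"
    using compact_distributions_obtain_Icc[OF assms(1)] .
  obtain N where N: "0 \<le> N" "measure G {-N..N} = 1"
    using compact_distributions_obtain_Icc[OF assms(2)] .
  interpret F: real_distribution F using assms by (auto simp: compact_distributions_def)
  interpret G: real_distribution G using assms by (auto simp: compact_distributions_def)
  have "measure F {-M..M} \<le> measure F {-max M N..max M N}"
    by (intro F.finite_measure_mono) auto
  moreover have "measure G {-N..N} \<le> measure G {-max M N..max M N}"
    by (intro G.finite_measure_mono) auto
  ultimately show thesis
    using M N by (intro that[of "max M N"] antisym) auto
qed

lemma set_integrable_Icc_bounded:
  fixes g :: "real \<Rightarrow> real"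
  assumes [measurable]: "g \<in> borel_measurable borel" and "\<And>x. \<bar>g x\<bar> \<le> B"
  shows "set_integrable lborel {a..b} g"
proof (rule set_integrable_bound)
  show "set_integrable lborel {a..b} (\<lambda>x. B)"
    by (intro borel_integrable_atLeastAtMost') auto
  show "set_borel_measurable lborel {a..b} g"
    by (simp add: set_borel_measurable_def)
  show "AE x in lborel. x \<in> {a..b} \<longrightarrow> norm (g x) \<le> norm B"
    using assms(2) by (auto intro!: AE_I2 intro: order_trans[OF _ abs_ge_self])
qed

context real_distribution
begin

lemma tail_mem: "measure M {x<..} \<in> {0..1}"
  using prob_le_1 by simp

lemma tail_antimono: "x \<le> y \<Longrightarrow> measure M {y<..} \<le> measure M {x<..}"
  by (intro finite_measure_mono) auto

lemma tail_eq_1: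
  assumes "measure M {a..b} = 1" "x < a"
  shows "measure M {x<..} = 1"
proof -
  have "measure M {a..b} \<le> measure M {x<..}"
    using assms by (intro finite_measure_mono) auto
  then show ?thesis
    using assms prob_le_1 by (intro antisym) auto
qed

lemma tail_eq_0:
  assumes "measure M {a..b} = 1" "b \<le> x"
  shows "measure M {x<..} = 0"
proof -
  have "measure M {x<..} \<le> measure M (space M - {a..b})"
    using assms by (intro finite_measure_mono) auto
  also have "\<dots> = 0"
    using assms by (subst prob_compl) auto
  finally show ?thesis
    by (simp add: measure_le_0_iff)
qed

text \<open>Stated for any increasing \<open>g\<close>, as it serves \<open>h\<close>, the shrunk
  distortions, a composed subgradient and the identity alike.\<close>

lemma measurable_distorted_tail:
  assumes "mono_on {0..1} g"
  shows "(\<lambda>x. g (measure M {x<..}) :: real) \<in> borel_measurable borel"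
proof -
  have "mono (\<lambda>x. - g (measure M {x<..}))"
    using tail_antimono tail_mem by (auto intro!: monoI mono_onD[OF assms])
  from borel_measurable_uminus[OF borel_measurable_mono[OF this]] show ?thesis
    by simp
qed

lemma distorted_tail_mem:
  assumes "mono_on {0..1} g"
  shows "g (measure M {x<..}) \<in> {g 0..g 1 :: real}"
  using tail_mem[of x] by (auto intro!: mono_onD[OF assms])

lemma set_integrable_distorted_tail:
  assumes "mono_on {0..1} g"
  shows "set_integrable lborel {a..b} (\<lambda>x. g (measure M {x<..}) :: real)"
proof (rule set_integrable_Icc_bounded[OF measurable_distorted_tail[OF assms]])
  show "\<bar>g (measure M {x<..})\<bar> \<le> max \<bar>g 0\<bar> \<bar>g 1\<bar>" for x
    using distorted_tail_mem[OF assms, of x] by (auto simp: abs_le_iff max_def)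
qed

text \<open>The tail is \<open>1\<close> left of \<open>-N\<close> and \<open>0\<close> from
  \<open>N\<close> on, so both integrands vanish outside the support interval; the term
  \<open>- h 1\<close> over \<open>{-N..0}\<close> contributes \<open>- N\<close>. Distributions on
  a common interval can thus be compared through one integral of distorted tails.\<close>

lemma dual_utility_eq_Icc:
  assumes mono: "mono_on {0..1} h" and h: "h 0 = 0" "h 1 = 1"
    and N: "0 \<le> N" "measure M {-N..N} = 1"
  shows "dual_utility h M = (LBINT x:{-N..N}. h (measure M {x<..})) - N"
proof -
  note int = set_integrable_distorted_tail[OF mono]
  have [measurable]: "(\<lambda>x. h (measure M {x<..})) \<in> borel_measurable borel"
    by (rule measurable_distorted_tail[OF mono])
  have "(LBINT x:{0..}. h (measure M {x<..})) = (LBINT x:{0..N}. h (measure M {x<..}))"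
    unfolding set_lebesgue_integral_def
    by (rule Bochner_Integration.integral_cong)
      (auto simp: indicator_def h tail_eq_0[OF N(2)])
  moreover have "(LBINT x:{..0}. h (measure M {x<..}) - h 1) =
      (LBINT x:{-N..0}. h (measure M {x<..}) - 1)"
    unfolding set_lebesgue_integral_def
    by (rule Bochner_Integration.integral_cong)
      (auto simp: indicator_def h tail_eq_1[OF N(2)])
  moreover have "\<dots> = (LBINT x:{-N..0}. h (measure M {x<..})) - (LBINT x:{-N..0}. 1)"
    by (intro set_integral_diff int borel_integrable_atLeastAtMost') auto
  moreover have "(LBINT x:{-N..0}. 1) = N"
    using N by (simp add: set_lebesgue_integral_def)
  moreover have "(LBINT x:{-N..0} \<union> {0..N}. h (measure M {x<..})) =
      (LBINT x:{-N..0}. h (measure M {x<..})) + (LBINT x:{0..N}. h (measure M {x<..}))"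
  proof (rule set_integral_Un_AE)
    show "AE x in lborel. \<not> (x \<in> {-N..0} \<and> x \<in> {0..N})"
      using AE_lborel_singleton[of 0] by eventually_elim auto
  qed (use int in auto)
  moreover have "{-N..0} \<union> {0..N} = {-N..N}"
    using N by auto
  ultimately show ?thesis
    by (simp add: dual_utility_def)
qed

text \<open>By Fubini, integrating over \<open>y\<close> first turns the indicator of
  \<open>x < y\<close> into the tail at \<open>x\<close>. The expectation of a primitive becomes a
  linear functional of the tail.\<close>

lemma expectation_interval_integral:
  fixes \<phi> :: "real \<Rightarrow> real"
  assumes [measurable]: "\<phi> \<in> borel_measurable borel" and bound: "\<And>x. \<bar>\<phi> x\<bar> \<le> B"
    and supp: "measure M {a..b} = 1"
    and meas: "(\<lambda>y::real. LBINT x=ereal a..ereal y. \<phi> x) \<in> borel_measurable borel"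
  shows "(\<integral>y. (LBINT x=ereal a..ereal y. \<phi> x) \<partial>M) = (LBINT x:{a..b}. \<phi> x * measure M {x<..})"
proof -
  \<comment> \<open>The cutoff at \<open>b\<close> keeps \<open>u\<close> integrable over the
    product; it changes nothing for \<open>y\<close> in \<open>{a..b}\<close>, which has full
    mass.\<close>
  define u where "u y x = (if a \<le> x \<and> x \<le> b \<and> x < y then \<phi> x else 0)" for y x :: real
  interpret P: pair_sigma_finite M lborel ..
  have u_meas [measurable]: "case_prod u \<in> borel_measurable (M \<Otimes>\<^sub>M lborel)"
    unfolding u_def by measurable
  have int: "integrable (M \<Otimes>\<^sub>M lborel) (case_prod u)"
  proof (rule Bochner_Integration.integrable_bound[OF _ u_meas])
    show "integrable (M \<Otimes>\<^sub>M lborel) (\<lambda>z. indicator (UNIV \<times> {a..b}) z * B)"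
      by (intro integrable_mult_left integrable_real_indicator)
        (auto simp: lborel.emeasure_pair_measure_Times emeasure_eq_measure ennreal_mult_less_top
          emeasure_lborel_Icc_eq)
    show "AE z in M \<Otimes>\<^sub>M lborel. norm (case_prod u z) \<le> norm (indicator (UNIV \<times> {a..b}) z * B)"
    proof (intro AE_I2)
      fix z :: "real \<times> real"
      have "\<bar>\<phi> (snd z)\<bar> \<le> \<bar>B\<bar>"
        using bound[of "snd z"] by linarith
      then show "norm (case_prod u z) \<le> norm (indicator (UNIV \<times> {a..b}) z * B)"
        by (cases z) (auto simp: u_def indicator_def)
    qed
  qed
  have "AE y in M. y \<in> {a..b}"
    using supp by (subst AE_in_set_eq_1) auto
  then have "AE y in M. (LBINT x=a..y. \<phi> x) = (LBINT x. u y x)"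
  proof eventually_elim
    case (elim y)
    have "(LBINT x=a..y. \<phi> x) = (LBINT x:{a<..<y}. \<phi> x)"
      using elim by (simp add: interval_integral_Ioo)
    also have "\<dots> = (LBINT x. u y x)"
      unfolding set_lebesgue_integral_def
      by (rule integral_cong_AE) (use elim AE_lborel_singleton[of a] in
        \<open>auto simp: u_def indicator_def elim!: eventually_mono\<close>)
    finally show ?case .
  qed
  then have "(\<integral>y. (LBINT x=a..y. \<phi> x) \<partial>M) = (\<integral>y. (LBINT x. u y x) \<partial>M)"
    using meas by (intro integral_cong_AE) (auto intro!: lborel.borel_measurable_lebesgue_integral)
  also have "\<dots> = (LBINT x. (\<integral>y. u y x \<partial>M))"
    using P.Fubini_integral[OF int] by simp
  also have "\<dots> = (LBINT x:{a..b}. \<phi> x * measure M {x<..})"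
    unfolding set_lebesgue_integral_def
  proof (rule Bochner_Integration.integral_cong[OF refl])
    fix x
    have "(\<integral>y. u y x \<partial>M) = (\<integral>y. (indicator {a..b} x * \<phi> x) * indicator {x<..} y \<partial>M)"
      by (rule Bochner_Integration.integral_cong) (auto simp: u_def indicator_def)
    also have "\<dots> = indicator {a..b} x * \<phi> x * measure M {x<..}"
      by (subst integral_mult_right_zero) simp
    finally show "(\<integral>y. u y x \<partial>M) = indicator {a..b} x *\<^sub>R (\<phi> x * measure M {x<..})"
      by simp
  qed
  finally show ?thesis .
qed

end

section \<open>Concave test functions and concave-order monotonicity\<close>

text \<open>At each \<open>z\<close> the line of slope \<open>\<phi> z\<close> through the graph
  lies above the primitive (\<open>support_le\<close>), which gives concavity. The oriented integral
  covers \<open>y < a\<close> too, as a test function must be concave on the whole line.\<close>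

lemma concave_on_interval_integral_antimono:
  fixes \<phi> :: "real \<Rightarrow> real"
  assumes anti: "antimono \<phi>"
  shows "concave_on UNIV (\<lambda>y. LBINT x=ereal a..ereal y. \<phi> x)"
proof -
  define f where "f y = (LBINT x=ereal a..ereal y. \<phi> x)" for y
  have "mono (\<lambda>x. - \<phi> x)"
    using anti by (auto simp: monotone_def)
  from borel_measurable_uminus[OF borel_measurable_mono[OF this]]
  have [measurable]: "\<phi> \<in> borel_measurable borel" by simp
  have int: "set_integrable lborel {c..d} \<phi>" for c d
  proof (rule set_integrable_bound)
    show "set_integrable lborel {c..d} (\<lambda>x. max \<bar>\<phi> c\<bar> \<bar>\<phi> d\<bar>)"
      by (intro borel_integrable_atLeastAtMost') auto
    show "set_borel_measurable lborel {c..d} \<phi>"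
      by (simp add: set_borel_measurable_def)
    show "AE x in lborel. x \<in> {c..d} \<longrightarrow> norm (\<phi> x) \<le> norm (max \<bar>\<phi> c\<bar> \<bar>\<phi> d\<bar>)"
      using antimonoD[OF anti] by (intro AE_I2) (force simp: abs_le_iff le_max_iff_disj)
  qed
  have diff: "f d - f c = (LBINT x:{c..d}. \<phi> x)" if "c \<le> d" for c d
  proof -
    define lo where "lo = min a (min c d)"
    define hi where "hi = max a (max c d)"
    have "min (ereal a) (min (ereal c) (ereal d)) = ereal lo"
      "max (ereal a) (max (ereal c) (ereal d)) = ereal hi"
      by (simp_all add: lo_def hi_def)
    moreover have "lo \<le> hi"
      by (simp add: lo_def hi_def)
    then have "interval_lebesgue_integrable lborel (ereal lo) (ereal hi) \<phi>"
      using set_integrable_subset[OF int[of lo hi], of "{lo<..<hi}"]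
      by (simp add: interval_lebesgue_integrable_def greaterThanLessThan_subseteq_atLeastAtMost_iff)
    ultimately have "f c + (LBINT x=c..d. \<phi> x) = f d"
      unfolding f_def by (intro interval_integral_sum) simp
    then show ?thesis
      using that by (simp add: interval_integral_Icc)
  qed
  have const: "(LBINT x:{c..d}. k) = k * (d - c)" if "c \<le> d" for c d k :: real
    using that by (simp add: set_lebesgue_integral_def)
  have support_le: "f y \<le> f z + \<phi> z * (y - z)" for y z
  proof (cases "z \<le> y")
    case True
    have "(LBINT x:{z..y}. \<phi> x) \<le> (LBINT x:{z..y}. \<phi> z)"
      using anti by (intro set_integral_mono int borel_integrable_atLeastAtMost') (auto dest: antimonoD)
    then show ?thesis
      using diff[OF True] const[OF True] by simp
  next
    case False
    then have "y \<le> z" by simp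
    have "(LBINT x:{y..z}. \<phi> z) \<le> (LBINT x:{y..z}. \<phi> x)"
      using anti by (intro set_integral_mono int borel_integrable_atLeastAtMost') (auto dest: antimonoD)
    then show ?thesis
      using diff[OF \<open>y \<le> z\<close>] const[OF \<open>y \<le> z\<close>, of "\<phi> z"] by (simp add: algebra_simps)
  qed
  have "concave_on UNIV f"
    unfolding concave_on_iff
  proof (intro conjI convex_UNIV ballI allI impI)
    fix x y u v :: real
    assume uv: "0 \<le> u" "0 \<le> v" "u + v = 1"
    define z where "z = u *\<^sub>R x + v *\<^sub>R y"
    have "u * f x + v * f y \<le> u * (f z + \<phi> z * (x - z)) + v * (f z + \<phi> z * (y - z))"
      using uv by (intro add_mono mult_left_mono support_le)
    also have "\<dots> = (u + v) * f z + \<phi> z * (u * x + v * y - (u + v) * z)"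
      by (simp add: algebra_simps)
    also have "\<dots> = f z"
      unfolding uv(3) by (simp add: z_def)
    finally show "u * f x + v * f y \<le> f (u *\<^sub>R x + v *\<^sub>R y)"
      by (simp add: z_def)
  qed
  then show ?thesis
    by (simp add: f_def[abs_def])
qed

text \<open>\<open>k s\<close> is the infimum of the slopes to the right of \<open>s\<close>, that
  is, the right derivative. Adding the subgradient inequalities at two points gives its
  monotonicity.\<close>

lemma convex_on_unit_subgradient:
  fixes h :: "real \<Rightarrow> real"
  assumes "convex_on {0..1} h"
  obtains k :: "real \<Rightarrow> real"
  where "\<And>s t. s \<in> {0<..<1} \<Longrightarrow> t \<in> {0..1} \<Longrightarrow> h s + k s * (t - s) \<le> h t"
    and "mono_on {0<..<1} k"
proof -
  define k where "k s = Inf ((\<lambda>t. (h s - h t) / (s - t)) ` ({s<..} \<inter> {0..1}))" for s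
  have k: "h s + k s * (t - s) \<le> h t" if "s \<in> {0<..<1}" "t \<in> {0..1}" for s t
    using convex_le_Inf_differential[OF assms, of s t] that
    by (simp add: k_def interior_atLeastAtMost_real)
  have "mono_on {0<..<1} k"
  proof (rule mono_onI)
    fix r s :: real assume rs: "r \<in> {0<..<1}" "s \<in> {0<..<1}" "r \<le> s"
    show "k r \<le> k s"
    proof (cases "r = s")
      case False
      have "0 \<le> (k s - k r) * (s - r)"
        using k[of r s] k[of s r] rs by (simp add: algebra_simps)
      then show ?thesis
        using False rs by (simp add: zero_le_mult_iff)
    qed simp
  qed
  with k show thesis
    by (rule that)
qed

text \<open>Shrinking the argument by \<open>e\<close> keeps it away from \<open>0\<close> and \<open>1\<close>, where \<open>h\<close> may have no
  finite subgradient.\<close>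

lemma concave_order_shrunk_distortion:
  fixes h :: "real \<Rightarrow> real"
  assumes conv: "convex_on {0..1} h" and mono: "mono_on {0..1} h"
    and F: "real_distribution F" and G: "real_distribution G"
    and supp: "measure F {a..b} = 1" "measure G {a..b} = 1"
    and ord: "concave_order F G" and e: "0 < e" "e < 1 / 2"
  shows "(LBINT x:{a..b}. h (e + (1 - 2 * e) * measure F {x<..})) \<le>
    (LBINT x:{a..b}. h (e + (1 - 2 * e) * measure G {x<..}))"
proof -
  interpret F: real_distribution F by (rule F)
  interpret G: real_distribution G by (rule G)
  define g where "g s = e + (1 - 2 * e) * s" for s :: real
  have g_mono: "g s \<le> g t" if "s \<le> t" for s t
    using that e by (auto simp: g_def intro!: mult_left_mono)
  have g01: "g s \<in> {0<..<1}" if "s \<in> {0..1}" for s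
  proof -
    have "g 0 = e" "g 1 = 1 - e"
      by (simp_all add: g_def)
    then show ?thesis
      using g_mono[of 0 s] g_mono[of s 1] that e by simp
  qed
  have hg_mono: "mono_on {0..1} (\<lambda>s. h (g s))"
    using g01 g_mono by (intro mono_onI mono_onD[OF mono]) (auto simp: less_imp_le)
  obtain k where k: "\<And>s t. s \<in> {0<..<1} \<Longrightarrow> t \<in> {0..1} \<Longrightarrow> h s + k s * (t - s) \<le> h t"
    and k_mono: "mono_on {0<..<1} k"
    using convex_on_unit_subgradient[OF conv] by blast
  \<comment> \<open>The subgradient is based at the shrunk tail of \<open>F\<close>, so that
    \<open>h\<close> at the shrunk tail of \<open>G\<close> is bounded below by the supporting line
    there. The tail decreases and \<open>k\<close> increases, so \<open>\<phi>\<close> is antitone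
    and its primitive \<open>f\<close> is a concave test function.\<close>
  define \<phi> where "\<phi> x = k (g (measure F {x<..}))" for x
  have kg_mono: "mono_on {0..1} (\<lambda>s. k (g s))"
    using g01 g_mono by (intro mono_onI mono_onD[OF k_mono]) auto
  have \<phi>_anti: "antimono \<phi>"
    using F.tail_antimono F.tail_mem
    by (auto simp: \<phi>_def intro!: antimonoI mono_onD[OF kg_mono])
  have [measurable]: "\<phi> \<in> borel_measurable borel"
    unfolding \<phi>_def by (rule F.measurable_distorted_tail[OF kg_mono])
  define B where "B = max \<bar>k (g 0)\<bar> \<bar>k (g 1)\<bar>"
  have bound: "\<bar>\<phi> x\<bar> \<le> B" for x
    using F.distorted_tail_mem[OF kg_mono, of x]
    by (auto simp: \<phi>_def B_def abs_le_iff max_def)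
  define f where "f y = (LBINT x=ereal a..ereal y. \<phi> x)" for y
  have conc: "concave_on UNIV f"
    unfolding f_def by (rule concave_on_interval_integral_antimono[OF \<phi>_anti])
  then have "continuous_on UNIV (\<lambda>y. - f y)"
    by (intro convex_on_continuous) (auto simp: concave_on_def)
  from continuous_on_minus[OF this] have meas: "f \<in> borel_measurable borel"
    by (intro borel_measurable_continuous_onI) simp
  have id_mono: "mono_on {0..1} (\<lambda>s::real. s)"
    by (rule mono_onI)
  have int\<phi>: "set_integrable lborel {a..b} (\<lambda>x. \<phi> x * measure H {x<..})"
    if "real_distribution H" for H
  proof -
    interpret H: real_distribution H by (rule that)
    have [measurable]: "(\<lambda>x. measure H {x<..}) \<in> borel_measurable borel"
      using H.measurable_distorted_tail[OF id_mono] .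
    show ?thesis
    proof (rule set_integrable_Icc_bounded)
      show "\<bar>\<phi> x * measure H {x<..}\<bar> \<le> B" for x
        using mult_mono[OF bound[of x] H.prob_le_1[of "{x<..}"]] order_trans[OF abs_ge_zero bound[of x]]
        by (simp add: abs_mult)
    qed measurable
  qed
  have "integral\<^sup>L F f \<le> integral\<^sup>L G f"
    using ord conc by (auto simp: concave_order_def)
  then have *: "(LBINT x:{a..b}. \<phi> x * measure F {x<..}) \<le> (LBINT x:{a..b}. \<phi> x * measure G {x<..})"
    using F.expectation_interval_integral[OF _ bound supp(1) meas[unfolded f_def]]
      G.expectation_interval_integral[OF _ bound supp(2) meas[unfolded f_def]]
    by (simp add: f_def[abs_def])
  let ?hF = "\<lambda>x. h (g (measure F {x<..}))" and ?hG = "\<lambda>x. h (g (measure G {x<..}))"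
  note int = F.set_integrable_distorted_tail[OF hg_mono] G.set_integrable_distorted_tail[OF hg_mono]
  \<comment> \<open>\<open>1 - 2 * e\<close> is the slope of \<open>g\<close>, so
    \<open>?d x\<close> is \<open>\<phi> x\<close> times the difference of the shrunk tails: the
    linear part of the subgradient inequality, whose integral is nonnegative by testing the order on
    \<open>f\<close>.\<close>
  let ?d = "\<lambda>x. (1 - 2 * e) * (\<phi> x * measure G {x<..} - \<phi> x * measure F {x<..})"
  have intd: "set_integrable lborel {a..b} ?d"
    by (intro set_integrable_mult_right set_integral_diff int\<phi> F G)
  have "0 \<le> (1 - 2 * e) * ((LBINT x:{a..b}. \<phi> x * measure G {x<..}) - (LBINT x:{a..b}. \<phi> x * measure F {x<..}))"
    using e * by simp
  also have "\<dots> = (LBINT x:{a..b}. ?d x)"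
    by (subst set_integral_mult_right, subst set_integral_diff) (auto intro: int\<phi> F G)
  also have "\<dots> \<le> (LBINT x:{a..b}. ?hG x - ?hF x)"
  proof (intro set_integral_mono intd set_integral_diff int)
    fix x
    have "h (g (measure F {x<..})) + \<phi> x * (g (measure G {x<..}) - g (measure F {x<..}))
        \<le> h (g (measure G {x<..}))"
      unfolding \<phi>_def using g01[OF F.tail_mem[of x]] g01[OF G.tail_mem[of x]] by (intro k) auto
    then show "?d x \<le> ?hG x - ?hF x"
      by (simp add: g_def algebra_simps)
  qed
  also have "\<dots> = (LBINT x:{a..b}. ?hG x) - (LBINT x:{a..b}. ?hF x)"
    by (intro set_integral_diff int)
  finally show ?thesis
    by (simp add: g_def)
qed

text \<open>Dominated convergence and continuity of \<open>h\<close>. The shift by \<open>3\<close>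
  keeps \<open>1 / real (n + 3)\<close> below \<open>1 / 2\<close> already for \<open>n = 0\<close>,
  as the inequality for shrunk tails requires.\<close>

lemma shrunk_distortion_tendsto:
  fixes h :: "real \<Rightarrow> real"
  assumes cont: "continuous_on {0..1} h" and mono: "mono_on {0..1} h" and F: "real_distribution F"
  shows "(\<lambda>n. LBINT x:{a..b}. h (1 / real (n + 3) + (1 - 2 * (1 / real (n + 3))) * measure F {x<..}))
    \<longlonglongrightarrow> (LBINT x:{a..b}. h (measure F {x<..}))"
proof -
  interpret F: real_distribution F by (rule F)
  define g where "g n s = 1 / real (n + 3) + (1 - 2 * (1 / real (n + 3))) * s" for n and s :: real
  have e: "0 < 1 / real (n + 3)" "1 / real (n + 3) < 1 / 2" for n
    by (auto simp: field_simps)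
  have g_mono: "g n s \<le> g n t" if "s \<le> t" for n s t
    using that e(2)[of n] unfolding g_def by (intro add_left_mono mult_left_mono) linarith+
  have g01: "g n s \<in> {0..1}" if "s \<in> {0..1}" for n s
  proof -
    have "g n 0 = 1 / real (n + 3)" "g n 1 = 1 - 1 / real (n + 3)"
      by (simp_all add: g_def)
    then have "1 / real (n + 3) \<le> g n s" "g n s \<le> 1 - 1 / real (n + 3)"
      using g_mono[of 0 s n] g_mono[of s 1 n] that by simp_all
    then show ?thesis
      using e(1)[of n] by (simp only: atLeastAtMost_iff) linarith
  qed
  have hg_mono: "mono_on {0..1} (\<lambda>s. h (g n s))" for n
    using g01 g_mono by (intro mono_onI mono_onD[OF mono]) auto
  have [measurable]: "(\<lambda>x. h (g n (measure F {x<..}))) \<in> borel_measurable borel"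
    "(\<lambda>x. h (measure F {x<..})) \<in> borel_measurable borel" for n
    using F.measurable_distorted_tail[OF hg_mono[of n]] F.measurable_distorted_tail[OF mono] .
  have "(\<lambda>n. LBINT x:{a..b}. h (g n (measure F {x<..}))) \<longlonglongrightarrow> (LBINT x:{a..b}. h (measure F {x<..}))"
    unfolding set_lebesgue_integral_def
  proof (rule integral_dominated_convergence)
    show "integrable lborel (\<lambda>x. indicator {a..b} x *\<^sub>R max \<bar>h 0\<bar> \<bar>h 1\<bar>)"
      by (intro integrable_scaleR_left integrable_real_indicator) (auto simp: emeasure_lborel_Icc_eq)
    show "AE x in lborel. (\<lambda>n. indicator {a..b} x *\<^sub>R h (g n (measure F {x<..})))
        \<longlonglongrightarrow> indicator {a..b} x *\<^sub>R h (measure F {x<..})"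
    proof (intro AE_I2 tendsto_intros)
      fix x
      have "(\<lambda>n. 1 / real (n + 3)) \<longlonglongrightarrow> 0"
        using LIMSEQ_ignore_initial_segment[OF lim_1_over_n, of 3] by simp
      then have "(\<lambda>n. g n (measure F {x<..})) \<longlonglongrightarrow> 0 + (1 - 2 * 0) * measure F {x<..}"
        unfolding g_def by (intro tendsto_intros)
      then show "(\<lambda>n. h (g n (measure F {x<..}))) \<longlonglongrightarrow> h (measure F {x<..})"
        using F.tail_mem[of x] g01 by (intro continuous_on_tendsto_compose[OF cont]) auto
    qed
    show "AE x in lborel. norm (indicator {a..b} x *\<^sub>R h (g n (measure F {x<..})))
        \<le> indicator {a..b} x *\<^sub>R max \<bar>h 0\<bar> \<bar>h 1\<bar>" for n
    proof (intro AE_I2)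
      fix x
      have "h (g n (measure F {x<..})) \<in> {h 0..h 1}"
        using g01[OF F.tail_mem[of x]] by (auto intro!: mono_onD[OF mono])
      then show "norm (indicator {a..b} x *\<^sub>R h (g n (measure F {x<..})))
          \<le> indicator {a..b} x *\<^sub>R max \<bar>h 0\<bar> \<bar>h 1\<bar>"
        by (auto simp: indicator_def abs_le_iff max_def)
    qed
  qed measurable
  then show ?thesis
    by (simp add: g_def)
qed

lemma convex_distortion_imp_concave_order_monotone:
  assumes cont: "continuous_on {0..1} h" and mono: "mono_on {0..1} h"
    and h: "h 0 = 0" "h 1 = 1" and conv: "convex_on {0..1} h"
  shows "concave_order_monotone (dual_utility h)"
  unfolding concave_order_monotone_def
proof (intro ballI impI)
  fix F G assume FG: "F \<in> compact_distributions" "G \<in> compact_distributions"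
    and ord: "concave_order F G"
  obtain M where M: "0 \<le> M" "measure F {-M..M} = 1" "measure G {-M..M} = 1"
    using compact_distributions_obtain_common_Icc[OF FG] .
  have F: "real_distribution F" and G: "real_distribution G"
    using FG by (auto simp: compact_distributions_def)
  have "(LBINT x:{-M..M}. h (measure F {x<..})) \<le> (LBINT x:{-M..M}. h (measure G {x<..}))"
  proof (rule LIMSEQ_le[OF shrunk_distortion_tendsto[OF cont mono F] shrunk_distortion_tendsto[OF cont mono G]],
      intro exI allI impI)
    fix n
    show "(LBINT x:{-M..M}. h (1 / real (n + 3) + (1 - 2 * (1 / real (n + 3))) * measure F {x<..}))
        \<le> (LBINT x:{-M..M}. h (1 / real (n + 3) + (1 - 2 * (1 / real (n + 3))) * measure G {x<..}))"
      by (rule concave_order_shrunk_distortion[OF conv mono F G M(2,3) ord]) (auto simp: field_simps)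
  qed
  then show "dual_utility h F \<le> dual_utility h G"
    using real_distribution.dual_utility_eq_Icc[OF F mono h M(1,2)]
      real_distribution.dual_utility_eq_Icc[OF G mono h M(1,3)] by simp
qed

section \<open>Mixtures and p-quasi-convexity\<close>

lemma tail_mixture:
  assumes "real_distribution F" "real_distribution G" "l \<in> {0..1}"
  shows "measure (mixture l F G) {x<..} = l * measure F {x<..} + (1 - l) * measure G {x<..}"
proof -
  interpret F: real_distribution F by (rule assms)
  interpret G: real_distribution G by (rule assms)
  have "emeasure (mixture l F G) {x<..} = ennreal (l * measure F {x<..} + (1 - l) * measure G {x<..})"
    using assms(3)
    by (simp add: emeasure_mixture F.emeasure_eq_measure G.emeasure_eq_measure ennreal_mult)
  then show ?thesis
    using assms(3) by (intro measure_eq_emeasure_eq_ennreal) auto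
qed

lemma convex_distortion_imp_p_quasi_convex:
  assumes mono: "mono_on {0..1} h" and h: "h 0 = 0" "h 1 = 1" and conv: "convex_on {0..1} h"
  shows "p_quasi_convex (dual_utility h)"
  unfolding p_quasi_convex_def
proof (intro ballI)
  fix F G and l :: real
  assume FG: "F \<in> compact_distributions" "G \<in> compact_distributions" and l: "l \<in> {0..1}"
  define H where "H = mixture l F G"
  have FGH: "real_distribution F" "real_distribution G" "real_distribution H"
    using FG mixture_compact_distributions[OF FG l] by (auto simp: compact_distributions_def H_def)
  interpret F: real_distribution F by (rule FGH)
  interpret G: real_distribution G by (rule FGH)
  interpret H: real_distribution H by (rule FGH)
  obtain M where M: "0 \<le> M" "measure F {-M..M} = 1" "measure G {-M..M} = 1"
    using compact_distributions_obtain_common_Icc[OF FG] .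
  \<comment> \<open>The mixture is carried by the same interval, so all three utilities reduce to
    integrals over it.\<close>
  have "emeasure H {-M..M} = ennreal (l * 1 + (1 - l) * 1)"
    using l M unfolding H_def
    by (subst emeasure_mixture) (simp_all add: F.emeasure_eq_measure G.emeasure_eq_measure
        ennreal_plus[symmetric] del: ennreal_plus)
  then have MH: "measure H {-M..M} = 1"
    by (simp add: measure_def)
  note int = F.set_integrable_distorted_tail[OF mono] G.set_integrable_distorted_tail[OF mono]
    H.set_integrable_distorted_tail[OF mono]
  have "(LBINT x:{-M..M}. h (measure H {x<..})) \<le>
      (LBINT x:{-M..M}. l * h (measure F {x<..}) + (1 - l) * h (measure G {x<..}))"
  proof (intro set_integral_mono int set_integral_add set_integrable_mult_right)
    fix x
    show "h (measure H {x<..}) \<le> l * h (measure F {x<..}) + (1 - l) * h (measure G {x<..})"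
      using convex_onD[OF conv, of l "measure G {x<..}" "measure F {x<..}"] l
        F.tail_mem[of x] G.tail_mem[of x]
      by (simp add: H_def tail_mixture[OF FGH(1,2) l] add.commute)
  qed
  also have "\<dots> = l * (LBINT x:{-M..M}. h (measure F {x<..})) + (1 - l) * (LBINT x:{-M..M}. h (measure G {x<..}))"
    by (subst set_integral_add) (auto intro: int)
  finally have "dual_utility h H \<le> l * dual_utility h F + (1 - l) * dual_utility h G"
    unfolding F.dual_utility_eq_Icc[OF mono h M(1,2)] G.dual_utility_eq_Icc[OF mono h M(1,3)]
      H.dual_utility_eq_Icc[OF mono h M(1) MH] by (simp add: algebra_simps)
  also have "\<dots> \<le> max (dual_utility h F) (dual_utility h G)"
    using l by (intro convex_bound_le) auto
  finally show "dual_utility h (mixture l F G) \<le> max (dual_utility h F) (dual_utility h G)"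
    by (simp add: H_def)
qed

section \<open>Three-point distributions\<close>

text \<open>For nonnegative \<open>w\<close> and \<open>w'\<close>, the masses make the tail
  \<open>p\<close> on \<open>{0..<w}\<close> and \<open>q\<close> on \<open>{w..<w + w'}\<close>.
  Taking the image of a measure on three labels lets the points coincide when \<open>w\<close> or
  \<open>w'\<close> is \<open>0\<close>.\<close>

definition three_point :: "real \<Rightarrow> real \<Rightarrow> real \<Rightarrow> real \<Rightarrow> real measure" where
  "three_point p q w w' =
     distr (point_measure {0, 1, 2 :: nat} (\<lambda>i. ennreal (if i = 0 then 1 - p else if i = 1 then p - q else q)))
       borel (\<lambda>i. if i = 0 then 0 else if i = 1 then w else w + w')"

context
  fixes p q :: real
  assumes pq: "0 \<le> q" "q \<le> p" "p \<le> 1"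
begin

lemma integral_three_point:
  fixes f :: "real \<Rightarrow> real"
  assumes [measurable]: "f \<in> borel_measurable borel"
  shows "integral\<^sup>L (three_point p q w w') f = (1 - p) * f 0 + (p - q) * f w + q * f (w + w')"
  using pq unfolding three_point_def
  by (subst integral_distr) (auto simp: lebesgue_integral_point_measure_finite)

lemma real_distribution_three_point: "real_distribution (three_point p q w w')"
proof -
  have "prob_space (point_measure {0, 1, 2 :: nat}
      (\<lambda>i. ennreal (if i = 0 then 1 - p else if i = 1 then p - q else q)))"
    using pq by (intro prob_spaceI)
      (simp add: space_point_measure emeasure_point_measure_finite ennreal_plus[symmetric] del: ennreal_plus)
  then have "prob_space (three_point p q w w')"
    unfolding three_point_def by (rule prob_space.prob_space_distr) simp
  then show ?thesis
    by (auto simp: real_distribution_def real_distribution_axioms_def three_point_def)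
qed

lemma measure_three_point:
  assumes "A \<in> sets borel"
  shows "measure (three_point p q w w') A =
    (1 - p) * indicator A 0 + (p - q) * indicator A w + q * indicator A (w + w')"
proof -
  interpret real_distribution "three_point p q w w'" by (rule real_distribution_three_point)
  have "measure (three_point p q w w') A = integral\<^sup>L (three_point p q w w') (indicator A)"
    using assms by simp
  then show ?thesis
    using integral_three_point[of "indicator A" w w'] assms by simp
qed

context
  fixes w w' :: real
  assumes w: "0 \<le> w" "0 \<le> w'"
begin

lemma measure_three_point_Icc: "measure (three_point p q w w') {-(w + w')..w + w'} = 1"
  using w by (simp add: measure_three_point)

lemma three_point_compact: "three_point p q w w' \<in> compact_distributions"
  using real_distribution_three_point measure_three_point_Icc
  by (auto simp: compact_distributions_def intro!: exI[of _ "{-(w + w')..w + w'}"])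

lemma dual_utility_three_point:
  assumes mono: "mono_on {0..1} h" and h: "h 0 = 0" "h 1 = 1"
  shows "dual_utility h (three_point p q w w') = w * h p + w' * h q"
proof -
  let ?M = "w + w'"
  interpret real_distribution "three_point p q w w'" by (rule real_distribution_three_point)
  \<comment> \<open>The piece left of \<open>0\<close>, where the tail is \<open>1\<close>, yields
    the length \<open>?M\<close> that \<open>dual_utility_eq_Icc\<close> subtracts again.\<close>
  have "(LBINT x:{-?M..?M}. h (measure (three_point p q w w') {x<..})) =
      (LBINT x. indicator {-?M..<0} x + h p * indicator {0..<w} x + h q * indicator {w..<?M} x)"
    unfolding set_lebesgue_integral_def
    by (rule Bochner_Integration.integral_cong)
      (use w in \<open>auto simp: indicator_def measure_three_point h\<close>)
  also have "\<dots> = ?M + w * h p + w' * h q"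
    using w by simp
  finally show ?thesis
    using dual_utility_eq_Icc[OF mono h _ measure_three_point_Icc] w by simp
qed

end

end

text \<open>With equal support points, mixing acts on the tail values alone. Only tails are
  compared, since they determine the dual utility.\<close>

lemma mixture_three_point_tail:
  assumes "0 \<le> q" "q \<le> p" "p \<le> 1" "0 \<le> q'" "q' \<le> p'" "p' \<le> 1" "l \<in> {0..1}"
  shows "measure (mixture l (three_point p q w w') (three_point p' q' w w')) {x<..} =
    measure (three_point (l * p + (1 - l) * p') (l * q + (1 - l) * q') w w') {x<..}"
proof -
  have "0 \<le> l * q + (1 - l) * q'" "l * q + (1 - l) * q' \<le> l * p + (1 - l) * p'"
    "l * p + (1 - l) * p' \<le> 1"
    using assms by (auto intro!: add_mono mult_left_mono convex_bound_le)
  with assms show ?thesis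
    by (simp add: tail_mixture real_distribution_three_point measure_three_point algebra_simps)
qed

section \<open>Convexity of the distortion from either property\<close>

lemma p_quasi_convex_imp_convex_distortion:
  assumes cont: "continuous_on {0..1} h" and mono: "mono_on {0..1} h"
    and h: "h 0 = 0" "h 1 = 1" and pqc: "p_quasi_convex (dual_utility h)"
  shows "convex_on {0..1} h"
proof (rule crossed_quasi_convexity_imp_convex_on[OF cont mono])
  fix u v a b :: real
  assume uvab: "0 \<le> u" "u \<le> v" "v \<le> a" "a \<le> b" "b \<le> 1"
  \<comment> \<open>These lengths solve \<open>w * h b + w' * h u = w * h a + w' * h v\<close>, so
    \<open>?F\<close> and \<open>?G\<close> below have equal utility and the maximum is that common
    value.\<close>
  define w where "w = h v - h u"
  define w' where "w' = h b - h a"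
  have w: "0 \<le> w" "0 \<le> w'"
    using uvab by (auto simp: w_def w'_def intro!: mono_onD[OF mono])
  \<comment> \<open>\<open>?F\<close> pairs the outer endpoints and \<open>?G\<close> the inner
    ones, so the even mixture has the two midpoints as tail values; \<open>v \<le> a\<close> makes
    the tail of \<open>?G\<close> decreasing.\<close>
  let ?F = "three_point b u w w'" and ?G = "three_point a v w w'"
  have "dual_utility h (mixture (1 / 2) ?F ?G) \<le> max (dual_utility h ?F) (dual_utility h ?G)"
    using pqc uvab w by (auto simp: p_quasi_convex_def three_point_compact)
  moreover have "dual_utility h (mixture (1 / 2) ?F ?G) =
      dual_utility h (three_point ((a + b) / 2) ((u + v) / 2) w w')"
    using mixture_three_point_tail[of u b v a "1 / 2"] uvab
    unfolding dual_utility_def by (simp add: field_simps)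
  moreover have "w * h b + w' * h u = h b * h v - h a * h u" "w * h a + w' * h v = h b * h v - h a * h u"
    by (simp_all add: w_def w'_def algebra_simps)
  ultimately have "w * h ((a + b) / 2) + w' * h ((u + v) / 2) \<le> h b * h v - h a * h u"
    using uvab w by (simp add: dual_utility_three_point[OF _ _ _ _ _ mono h])
  then show "(h v - h u) * h ((a + b) / 2) + (h b - h a) * h ((u + v) / 2) \<le> h b * h v - h a * h u"
    by (simp add: w_def w'_def)
qed

text \<open>With \<open>m\<close> the midpoint of \<open>l\<close> and \<open>r\<close>, moving mass
  \<open>(r - l) / 2\<close> from each of \<open>0\<close> and \<open>2\<close> to \<open>1\<close>
  turns \<open>three_point m m 1 1\<close> into \<open>three_point r l 1 1\<close>, a
  mean-preserving contraction. The utilities are \<open>2 * h m\<close> and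
  \<open>h r + h l\<close>.\<close>

lemma concave_order_monotone_imp_convex_distortion:
  assumes cont: "continuous_on {0..1} h" and mono: "mono_on {0..1} h"
    and h: "h 0 = 0" "h 1 = 1" and com: "concave_order_monotone (dual_utility h)"
  shows "convex_on {0..1} h"
proof (rule midpoint_convex_imp_convex_on[OF cont])
  fix l r :: real assume lr: "0 \<le> l" "l \<le> r" "r \<le> 1"
  define m where "m = (l + r) / 2"
  have m: "0 \<le> m" "m \<le> 1"
    using lr by (auto simp: m_def)
  have "concave_order (three_point m m 1 1) (three_point r l 1 1)"
    unfolding concave_order_def
  proof (intro allI impI)
    fix f :: "real \<Rightarrow> real" assume f: "concave_on UNIV f"
    then have "continuous_on UNIV (\<lambda>y. - f y)"
      by (intro convex_on_continuous) (auto simp: concave_on_def)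
    from continuous_on_minus[OF this] have [measurable]: "f \<in> borel_measurable borel"
      by (intro borel_measurable_continuous_onI) simp
    have "f 0 / 2 + f 2 / 2 \<le> f 1"
      using concave_onD[OF f, of "1 / 2" 0 2] by simp
    then have "(r - l) * (f 0 / 2 + f 2 / 2) \<le> (r - l) * f 1"
      using lr by (intro mult_left_mono) auto
    then show "integral\<^sup>L (three_point m m 1 1) f \<le> integral\<^sup>L (three_point r l 1 1) f"
      using lr m by (simp add: integral_three_point) (simp add: m_def field_simps)
  qed
  then have "dual_utility h (three_point m m 1 1) \<le> dual_utility h (three_point r l 1 1)"
    using com lr m by (auto simp: concave_order_monotone_def three_point_compact)
  then show "h ((l + r) / 2) \<le> (h l + h r) / 2"
    using lr m by (simp add: dual_utility_three_point[OF _ _ _ _ _ mono h] m_def)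
qed

theorem corollary1:
  fixes h :: "real \<Rightarrow> real"
  assumes "continuous_on {0..1} h"
    and "mono_on {0..1} h"
    and "h 0 = 0"
    and "h 1 = 1"
  shows "p_quasi_convex (dual_utility h) \<longleftrightarrow> concave_order_monotone (dual_utility h)"
  using p_quasi_convex_imp_convex_distortion[OF assms] convex_distortion_imp_concave_order_monotone[OF assms]
    concave_order_monotone_imp_convex_distortion[OF assms] convex_distortion_imp_p_quasi_convex[OF assms(2-4)]
  by blast

end
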